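(* Let $M$ be a finitely generated right module over the free associative algebra $R=\mathcal{A}_r$ of rank $r>1$ over a field $\Phi$, with growth function $g(n)$ (with respect to a finite generating set). If the function $\dfrac{r^n}{g(n)}$ is subexponential, then $M$ is a faithful $R$-module. In particular, any $R$-module of maximal growth is faithful.
   Context: A right $R$-module $M$ is faithful if $\mathrm{Ann}_RM=\{a\in R : Ma=0\}$ is zero. A function $f$ on $\mathbb{N}$ with positive values is subexponential if $\limsup_{n\to\infty}\sqrt[n]{f(n)}\le1$. $R=\Phi\langle x_1,\ldots,x_r\rangle$, and $R(n)$ is the span of monomials of degree at most $n$. For a module $M$ generated by a finite set $A$ the growth function is $g(n)=g_{A,M}(n)=\dim_\Phi(AR(n))$. Functions $f,g$ are equivalent if for some nonnegative integers $C,C'$ one has $f(n)\le g(n+C)$ and $g(n)\le f(n+C')$ for all $n\ge0$. A finitely generated module has maximal growth if its growth function is equivalent to that of the free module of rank 1, i.e. to $r^n$ (independently of the finite generating set); an arbitrary module has maximal growth if it contains a finitely generated submodule of maximal growth. *)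

theory Defs
  imports "HOL-Library.Poly_Mapping" "HOL-Library.Extended_Real" "HOL-Library.Liminf_Limsup"
    "HOL-Library.Cardinality"
begin

section \<open>The free associative algebra\<close>

text \<open>
  Words are wrapped in a datatype, so that concatenation can serve as the (noncommutative) addition
  of the exponents of \<^typ>\<open>'a \<Rightarrow>\<^sub>0 'b\<close>. The convolution product of the latter is then the product
  of the free associative algebra over \<open>'k\<close> on the free generators \<open>'x\<close>; its rank is \<open>CARD('x)\<close>.
\<close>

datatype 'x monomial = Monomial (letters: "'x list")

instantiation monomial :: (type) monoid_add
begin

definition zero_monomial :: "'a monomial"
  where "0 = Monomial []"

definition plus_monomial :: "'a monomial \<Rightarrow> 'a monomial \<Rightarrow> 'a monomial"
  where "u + v = Monomial (letters u @ letters v)"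

instance
  by standard (simp_all add: zero_monomial_def plus_monomial_def)

end

type_synonym ('x, 'k) free_algebra = "'x monomial \<Rightarrow>\<^sub>0 'k"


section \<open>Right modules\<close>

locale right_module =
  fixes act :: "'m::ab_group_add \<Rightarrow> ('x, 'k::field) free_algebra \<Rightarrow> 'm"
  assumes act_add_left: "act (m + m') a = act m a + act m' a"
    and act_add_right: "act m (a + b) = act m a + act m b"
    and act_mult: "act m (a * b) = act (act m a) b"
    and act_one: "act m 1 = m"

text \<open>The ground field acts through its copy \<^term>\<open>Poly_Mapping.single 0 c\<close> in the free algebra.\<close>

definition ground_scale ::
    "('m::ab_group_add \<Rightarrow> ('x, 'k::field) free_algebra \<Rightarrow> 'm) \<Rightarrow> 'k \<Rightarrow> 'm \<Rightarrow> 'm"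
  where "ground_scale act c m = act m (Poly_Mapping.single 0 c)"

sublocale right_module \<subseteq> vector_space "ground_scale act"
proof
  fix a b :: 'k and x y :: 'm
  show "ground_scale act a (x + y) = ground_scale act a x + ground_scale act a y"
    by (simp add: ground_scale_def act_add_left)
  show "ground_scale act (a + b) x = ground_scale act a x + ground_scale act b x"
    by (simp add: ground_scale_def single_add act_add_right)
  show "ground_scale act a (ground_scale act b x) = ground_scale act (a * b) x"
    by (simp add: ground_scale_def act_mult[symmetric] mult_single mult.commute)
  show "ground_scale act 1 x = x"
    by (simp add: ground_scale_def act_one)
qed

lemma right_module_regular:
  "right_module ((*) :: ('x, 'k::field) free_algebra \<Rightarrow> ('x, 'k) free_algebra \<Rightarrow> ('x, 'k) free_algebra)"
  by standard (simp_all add: distrib_left distrib_right mult.assoc)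

definition submodule ::
    "('m::ab_group_add \<Rightarrow> ('x, 'k::field) free_algebra \<Rightarrow> 'm) \<Rightarrow> 'm set \<Rightarrow> bool"
  where "submodule act N \<longleftrightarrow>
    0 \<in> N \<and> (\<forall>m\<in>N. \<forall>m'\<in>N. m + m' \<in> N) \<and> (\<forall>m\<in>N. \<forall>a. act m a \<in> N)"

definition generated_submodule ::
    "('m::ab_group_add \<Rightarrow> ('x, 'k::field) free_algebra \<Rightarrow> 'm) \<Rightarrow> 'm set \<Rightarrow> 'm set"
  where "generated_submodule act A = submodule act hull A"

definition annihilator ::
    "('m::ab_group_add \<Rightarrow> ('x, 'k::field) free_algebra \<Rightarrow> 'm) \<Rightarrow> ('x, 'k) free_algebra set"
  where "annihilator act = {a. \<forall>m. act m a = 0}"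

definition faithful ::
    "('m::ab_group_add \<Rightarrow> ('x, 'k::field) free_algebra \<Rightarrow> 'm) \<Rightarrow> bool"
  where "faithful act \<longleftrightarrow> annihilator act = {0}"


section \<open>Growth\<close>

text \<open>The subspace \<open>R(n)\<close> of the free algebra \<open>R\<close>.\<close>

definition degree_le :: "nat \<Rightarrow> ('x, 'k::field) free_algebra set"
  where "degree_le n =
    module.span (ground_scale (*)) {Poly_Mapping.single w 1 | w. length (letters w) \<le> n}"

text \<open>The subspace \<open>A R(n)\<close> of a module, for a subset \<open>A\<close> of it.\<close>

definition growth_space ::
    "('m::ab_group_add \<Rightarrow> ('x, 'k::field) free_algebra \<Rightarrow> 'm) \<Rightarrow> 'm set \<Rightarrow> nat \<Rightarrow> 'm set"
  where "growth_space act A n =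
    module.span (ground_scale act) {act m a | m a. m \<in> A \<and> a \<in> degree_le n}"

text \<open>
  Here \<^const>\<open>vector_space.dim\<close> is the true dimension: for finite \<open>A\<close> and finitely many free
  generators all spaces involved are finite-dimensional.
\<close>

definition growth ::
    "('m::ab_group_add \<Rightarrow> ('x, 'k::field) free_algebra \<Rightarrow> 'm) \<Rightarrow> 'm set \<Rightarrow> nat \<Rightarrow> nat"
  where "growth act A n = vector_space.dim (ground_scale act) (growth_space act A n)"

definition growth_equivalent :: "(nat \<Rightarrow> nat) \<Rightarrow> (nat \<Rightarrow> nat) \<Rightarrow> bool"
  where "growth_equivalent f g \<longleftrightarrow>
    (\<exists>C C'. \<forall>n. f n \<le> g (n + C) \<and> g n \<le> f (n + C'))"

text \<open>
  Positivity is part of the notion. For \<open>f n = r ^ n / g n\<close> it excludes \<open>g n = 0\<close>, that is, the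
  zero module, for which the quotient would be \<open>0\<close> by the convention on division by zero.
\<close>

definition subexponential :: "(nat \<Rightarrow> real) \<Rightarrow> bool"
  where "subexponential f \<longleftrightarrow>
    (\<forall>n. f n > 0) \<and> limsup (\<lambda>n. ereal (root n (f n))) \<le> 1"

text \<open>
  The free module of rank 1 is the algebra acting on itself by right multiplication, with free
  generator \<open>1\<close>. Up to equivalence its growth is \<open>r ^ n\<close>.
\<close>

lemma card_words: "card {w :: 'x::finite monomial. length (letters w) \<le> n} = (\<Sum>i\<le>n. CARD('x) ^ i)"
proof -
  have "{w :: 'x monomial. length (letters w) \<le> n} = Monomial ` {xs. set xs \<subseteq> UNIV \<and> length xs \<le> n}"
    by (auto simp: image_iff intro: monomial.collapse[symmetric])
  then show ?thesis
    by (simp add: card_image inj_on_def card_lists_length_le[of "UNIV :: 'x set", simplified])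
qed

lemma ground_scale_regular_single:
  "ground_scale (*) c (Poly_Mapping.single w 1) = Poly_Mapping.single w (c::'k::field)"
  by (simp add: ground_scale_def mult_single)

lemma growth_regular:
  "growth ((*) :: ('x::finite, 'k::field) free_algebra \<Rightarrow> ('x, 'k) free_algebra \<Rightarrow> ('x, 'k) free_algebra) {1} n
    = (\<Sum>i\<le>n. CARD('x) ^ i)"
proof -
  let ?s = "ground_scale ((*) :: ('x, 'k) free_algebra \<Rightarrow> ('x, 'k) free_algebra \<Rightarrow> ('x, 'k) free_algebra)"
  let ?W = "{w :: 'x monomial. length (letters w) \<le> n}"
  let ?e = "\<lambda>w :: 'x monomial. Poly_Mapping.single w (1::'k)"
  interpret right_module "(*) :: ('x, 'k) free_algebra \<Rightarrow> ('x, 'k) free_algebra \<Rightarrow> ('x, 'k) free_algebra"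
    by (rule right_module_regular)
  have inj: "inj ?e" by (rule injI) (metis lookup_single_eq lookup_single_not_eq one_neq_zero)
  have W: "{Poly_Mapping.single w 1 | w. length (letters w) \<le> n} = ?e ` ?W" by auto
  have sp: "growth_space (*) {1} n = span (?e ` ?W)"
    by (simp add: growth_space_def degree_le_def W span_span)
  have "independent (?e ` ?W)"
    unfolding independent_explicit_module
  proof (intro allI impI)
    fix t u v assume t: "finite t" "t \<subseteq> ?e ` ?W" "(\<Sum>v\<in>t. ?s (u v) v) = 0" "v \<in> t"
    then obtain w where w: "v = ?e w" by auto
    have "0 = Poly_Mapping.lookup (\<Sum>v\<in>t. ?s (u v) v) w" using t by simp
    also have "\<dots> = (\<Sum>v'\<in>t. Poly_Mapping.lookup (?s (u v') v') w)" by (simp add: lookup_sum)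
    also have "\<dots> = (\<Sum>v'\<in>t. if v' = v then u v else 0)"
    proof (rule sum.cong[OF refl])
      fix v' assume "v' \<in> t"
      then obtain w' where "v' = ?e w'" using t by auto
      then show "Poly_Mapping.lookup (?s (u v') v') w = (if v' = v then u v else 0)"
        using w inj by (auto simp: ground_scale_regular_single lookup_single when_def dest: injD)
    qed
    also have "\<dots> = u v" using t by simp
    finally show "u v = 0" by simp
  qed
  then have "dim (span (?e ` ?W)) = card (?e ` ?W)" by (rule dim_span_eq_card_independent)
  then show ?thesis
    using inj by (simp add: growth_def sp card_image card_words inj_on_subset)
qed

lemma growth_equivalent_regular:
  assumes "CARD('x::finite) > 1"
  shows "growth_equivalent
    (growth ((*) :: ('x, 'k::field) free_algebra \<Rightarrow> ('x, 'k) free_algebra \<Rightarrow> ('x, 'k) free_algebra) {1})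
    (\<lambda>n. CARD('x) ^ n)"
proof -
  let ?r = "CARD('x)"
  have "(\<Sum>i\<le>n. ?r ^ i) \<le> ?r ^ (n + 1)" for n
  proof (induction n)
    case (Suc n)
    have "(\<Sum>i\<le>Suc n. ?r ^ i) \<le> 2 * ?r ^ (n + 1)" using Suc by simp
    also have "\<dots> \<le> ?r * ?r ^ (n + 1)" using assms by (intro mult_right_mono) auto
    finally show ?case by simp
  qed (use assms in simp)
  moreover have "?r ^ n \<le> (\<Sum>i\<le>n + 0. ?r ^ i)" for n
    by (rule member_le_sum) auto
  ultimately show ?thesis unfolding growth_equivalent_def growth_regular by blast
qed

text \<open>
  The equivalence does not depend on the finite generating set, so that asking for one such set is
  the same as asking for all of them.
\<close>

definition fg_maximal_growth ::
    "('m::ab_group_add \<Rightarrow> ('x, 'k::field) free_algebra \<Rightarrow> 'm) \<Rightarrow> 'm set \<Rightarrow> bool"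
  where "fg_maximal_growth act N \<longleftrightarrow>
    (\<exists>A. finite A \<and> generated_submodule act A = N \<and>
      growth_equivalent (growth act A)
        (growth ((*) :: ('x, 'k) free_algebra \<Rightarrow> ('x, 'k) free_algebra \<Rightarrow> ('x, 'k) free_algebra) {1}))"

definition maximal_growth ::
    "('m::ab_group_add \<Rightarrow> ('x, 'k::field) free_algebra \<Rightarrow> 'm) \<Rightarrow> bool"
  where "maximal_growth act \<longleftrightarrow> (\<exists>N. submodule act N \<and> fg_maximal_growth act N)"

end

theory Submission
  imports Defs "HOL-Library.Sublist"
begin

text \<open>
  Suppose \<open>a \<noteq> 0\<close> annihilates the module, and let \<open>w\<close> be the leading word of \<open>a\<close> with respect to the
  length-lexicographic order. For every \<open>m\<close> and all words \<open>p\<close>, \<open>q\<close> the relation \<open>m p a q = 0\<close> expresses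
  \<open>m p w q\<close> through elements \<open>m v\<close> with smaller words \<open>v\<close>; hence \<open>A R(n)\<close> is spanned by the \<open>m v\<close> with
  \<open>m \<in> A\<close> and \<open>v\<close> of length at most \<open>n\<close> without factor \<open>w\<close>. With \<open>d = |w|\<close>, cutting words into blocks of
  length \<open>d\<close> shows that their number is at most \<open>K (n + 1) s ^ n\<close> where
  \<open>s = (r ^ d - 1) powr (1 / d) < r\<close>, so \<open>r ^ n / g n\<close> grows exponentially.
\<close>

section \<open>Words avoiding a factor\<close>

definition avoiding :: "'x list \<Rightarrow> nat \<Rightarrow> 'x list set"
  where "avoiding w n = {v. length v = n \<and> \<not> sublist w v}"

lemma finite_avoiding: "finite (avoiding (w :: 'x::finite list) n)"
  using finite_lists_length_eq[of "UNIV :: 'x set" n]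
  by (rule finite_subset[rotated]) (auto simp: avoiding_def)

lemma card_avoiding_le: "card (avoiding (w :: 'x::finite list) n) \<le> CARD('x) ^ n"
proof -
  have "card (avoiding w n) \<le> card {v :: 'x list. set v \<subseteq> UNIV \<and> length v = n}"
    by (rule card_mono[OF finite_lists_length_eq]) (auto simp: avoiding_def)
  then show ?thesis by (simp add: card_lists_length_eq[of "UNIV :: 'x set", simplified])
qed

text \<open>Cut off the prefix of length \<open>length w\<close>: it differs from \<open>w\<close>,
  which excludes one of the \<open>CARD('x) ^ length w\<close> blocks, and the remaining suffix
  still avoids \<open>w\<close>. The two pieces determine the word.\<close>

lemma card_avoiding_add_length:
  fixes w :: "'x::finite list"
  shows "card (avoiding w (length w + n)) \<le> (CARD('x) ^ length w - 1) * card (avoiding w n)"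
proof -
  let ?d = "length w"
  let ?W = "{v :: 'x list. length v = ?d}"
  have fin: "finite ?W" using finite_lists_length_eq[of "UNIV :: 'x set" ?d] by simp
  have "card (avoiding w (?d + n)) \<le> card ((?W - {w}) \<times> avoiding w n)"
  proof (rule card_inj_on_le)
    show "inj_on (\<lambda>v. (take ?d v, drop ?d v)) (avoiding w (?d + n))"
      by (rule inj_onI) (metis append_take_drop_id prod.inject)
    show "(\<lambda>v. (take ?d v, drop ?d v)) ` avoiding w (?d + n) \<subseteq> (?W - {w}) \<times> avoiding w n"
    proof safe
      fix v assume v: "v \<in> avoiding w (?d + n)"
      then show "length (take ?d v) = ?d" by (simp add: avoiding_def)
      show "drop ?d v \<in> avoiding w n"
        using v by (auto simp: avoiding_def dest: sublist_order.order_trans[OF _ sublist_drop])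
      show False if "take ?d v = w"
        using v sublist_take[of ?d v] that by (simp add: avoiding_def)
    qed
    show "finite ((?W - {w}) \<times> avoiding w n)" using fin finite_avoiding by blast
  qed
  also have "\<dots> = (CARD('x) ^ ?d - 1) * card (avoiding w n)"
    using card_lists_length_eq[of "UNIV :: 'x set" ?d] fin by (simp add: card_cartesian_product)
  finally show ?thesis .
qed

text \<open>Each block of length \<open>d = length w\<close> costs a factor \<open>r ^ d - 1\<close>
  instead of \<open>r ^ d\<close>, so the rate \<open>s\<close> is the \<open>d\<close>-th root of
  \<open>r ^ d - 1\<close>. The constant \<open>K = r ^ d\<close> absorbs the last incomplete
  block.\<close>

lemma card_avoiding_exponential:
  fixes w :: "'x::finite list"
  assumes "CARD('x) > 1"
  obtains K s :: real where "K > 0" "1 \<le> s" "s < CARD('x)"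
    "\<And>n. card (avoiding w n) \<le> K * s ^ n"
proof (cases "w = []")
  case True
  \<comment> \<open>Every word has the empty word as a factor, so the sets are empty and any
    constants serve.\<close>
  then show ?thesis using assms by (intro that[of 1 1]) (auto simp: avoiding_def)
next
  case False
  define r d where "r = CARD('x)" and "d = length w"
  define s where "s = root d (real (r ^ d - 1))"
  have d: "d > 0" and r: "r > 1" using False assms by (simp_all add: d_def r_def)
  have "2 \<le> r ^ d" using r d by (metis Suc_1 Suc_leI one_less_power)
  then have one: "1 \<le> real (r ^ d - 1)" by linarith
  have sd: "s ^ d = real (r ^ d - 1)"
    unfolding s_def using d by (intro real_root_pow_pos2) auto
  have s1: "1 \<le> s"
    unfolding s_def using d one by (simp only: real_root_ge_1_iff)
  have "s ^ d < real r ^ d" unfolding sd using \<open>2 \<le> r ^ d\<close> by (simp add: of_nat_diff)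
  then have sr: "s < r" by (rule power_less_imp_less_base) simp
  have "card (avoiding w n) \<le> real r ^ d * s ^ n" for n
  proof (induction n rule: less_induct)
    case (less n)
    show ?case
    proof (cases "n < d")
      case True
      have "real (card (avoiding w n)) \<le> real r ^ n"
        using card_avoiding_le[of w n] by (simp add: r_def flip: of_nat_power)
      also have "\<dots> \<le> real r ^ d * 1" using True r by (simp add: power_increasing)
      also have "\<dots> \<le> real r ^ d * s ^ n" using s1 by (intro mult_left_mono) auto
      finally show ?thesis .
    next
      case False
      define m where "m = n - d"
      have n: "n = d + m" "m < n" using False d by (auto simp: m_def)
      have "real (card (avoiding w n)) \<le> real ((r ^ d - 1) * card (avoiding w m))"
        using card_avoiding_add_length[of w m] unfolding n r_def d_def of_nat_le_iff .
      also have "\<dots> = s ^ d * card (avoiding w m)" by (simp add: sd)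
      also have "\<dots> \<le> s ^ d * (real r ^ d * s ^ m)" using less[OF n(2)] s1 by (intro mult_left_mono) auto
      finally show ?thesis by (simp add: n(1) power_add mult_ac)
    qed
  qed
  then show ?thesis using that[of "real r ^ d" s] s1 sr r by (simp add: r_def)
qed

text \<open>Since \<open>1 \<le> s\<close>, each of the \<open>n + 1\<close> lengths contributes at
  most \<open>K * s ^ n\<close>; a polynomial factor does not affect the exponential rate.\<close>

lemma card_avoiding_atMost:
  fixes w :: "'x::finite list"
  assumes "CARD('x) > 1"
  obtains K s :: real where "K > 0" "1 \<le> s" "s < CARD('x)"
    "\<And>n. card (\<Union>i\<le>n. avoiding w i) \<le> K * (real n + 1) * s ^ n"
proof -
  obtain K s :: real where K: "K > 0" and s: "1 \<le> s" "s < CARD('x)"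
    and le: "\<And>n. card (avoiding w n) \<le> K * s ^ n"
    using card_avoiding_exponential[OF assms, of w] by metis
  have "card (\<Union>i\<le>n. avoiding w i) \<le> K * (real n + 1) * s ^ n" for n
  proof -
    have "real (card (\<Union>i\<le>n. avoiding w i)) \<le> real (\<Sum>i\<le>n. card (avoiding w i))"
      by (simp only: of_nat_le_iff) (rule card_UN_le, simp)
    also have "\<dots> = (\<Sum>i\<le>n. real (card (avoiding w i)))" by simp
    also have "\<dots> \<le> (\<Sum>i\<le>n. K * s ^ n)"
    proof (rule sum_mono)
      fix i assume "i \<in> {..n}"
      then have "K * s ^ i \<le> K * s ^ n" using K s by (intro mult_left_mono power_increasing) auto
      with le[of i] show "real (card (avoiding w i)) \<le> K * s ^ n" by linarith
    qed
    finally show ?thesis by (simp add: algebra_simps)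
  qed
  with K s show ?thesis using that by blast
qed

section \<open>Reduction modulo the annihilator\<close>

text \<open>The length-lexicographic order. Compatibility with multiplication on both sides keeps a
  leading word leading inside any context \<open>p\<close>, \<open>q\<close>; the length condition
  keeps reductions within the same degree bound.\<close>

lemma word_order:
  obtains L :: "('x::finite list \<times> 'x list) set"
  where "wf L" "total L" "trans L"
    "\<And>u v. (u, v) \<in> L \<Longrightarrow> length u \<le> length v"
    "\<And>p q u v. (u, v) \<in> L \<Longrightarrow> (p @ u @ q, p @ v @ q) \<in> L"
proof -
  \<comment> \<open>The letters carry no order of their own; one is pulled back from the natural
    numbers.\<close>
  obtain f :: "'x \<Rightarrow> nat" where f: "inj f"
    using finite_imp_inj_to_nat_seg[of "UNIV :: 'x set"] by auto
  define R where "R = inv_image less_than f"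
  have "wf R" "trans R" "irrefl R"
    by (auto simp: R_def trans_inv_image irrefl_def)
  moreover have "total R"
    using f unfolding R_def total_on_def by (metis in_inv_image injD less_than_iff linorder_neqE_nat)
  ultimately show ?thesis
    by (intro that[of "lenlex R"]) (auto simp: total_lenlex lenlex_append1 dest: lenlex_length)
qed

abbreviation word :: "'x list \<Rightarrow> ('x, 'k::field) free_algebra"
  where "word v \<equiv> Poly_Mapping.single (Monomial v) 1"

context right_module
begin

lemma act_zero_right: "act m 0 = 0"
  using act_add_right[of m 0 0] by simp

lemma act_zero_left: "act 0 a = 0"
  using act_add_left[of 0 0 a] by simp

lemma act_sum_left: "act (\<Sum>i\<in>I. f i) a = (\<Sum>i\<in>I. act (f i) a)"
  by (induction I rule: infinite_finite_induct) (simp_all add: act_zero_left act_add_left)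

lemma act_sum_right: "act m (\<Sum>i\<in>I. f i) = (\<Sum>i\<in>I. act m (f i))"
  by (induction I rule: infinite_finite_induct) (simp_all add: act_zero_right act_add_right)

lemma act_scale_right: "act m (ground_scale (*) c a) = ground_scale act c (act m a)"
  by (simp add: ground_scale_def act_mult)

lemma act_word_append: "act m (word (u @ v)) = act (act m (word u)) (word v)"
  by (simp add: act_mult[symmetric] mult_single plus_monomial_def)

lemma act_word_scale: "act (ground_scale act c m) (word v) = ground_scale act c (act m (word v))"
  by (simp add: ground_scale_def act_mult[symmetric] mult_single)

lemma act_single: "act m (Poly_Mapping.single v c) = ground_scale act c (act m (word (letters v)))"
  using act_scale_right[of m c "word (letters v)"] by (simp add: ground_scale_regular_single)

text \<open>Turns \<open>act m a = 0\<close> into a linear relation between the elements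
  \<open>act m (word v)\<close>.\<close>

lemma act_eq_sum:
  "act m a = (\<Sum>v\<in>Poly_Mapping.keys a. ground_scale act (Poly_Mapping.lookup a v) (act m (word (letters v))))"
proof -
  have "a = (\<Sum>v\<in>Poly_Mapping.keys a. Poly_Mapping.single v (Poly_Mapping.lookup a v))"
    by (rule poly_mapping_eqI)
      (auto simp: lookup_sum lookup_single when_def in_keys_iff)
  then have "act m a = act m (\<Sum>v\<in>Poly_Mapping.keys a. Poly_Mapping.single v (Poly_Mapping.lookup a v))"
    by (rule arg_cong)
  then show ?thesis by (simp only: act_sum_right act_single[symmetric])
qed

lemma act_degree_le_in_span:
  assumes "a \<in> degree_le n"
  shows "act m a \<in> span ((\<lambda>v. act m (word v)) ` {v. length v \<le> n})"
proof -
  interpret reg: right_module "(*) :: ('x, 'k) free_algebra \<Rightarrow> ('x, 'k) free_algebra \<Rightarrow> ('x, 'k) free_algebra"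
    by (rule right_module_regular)
  have "a \<in> reg.span {Poly_Mapping.single w 1 | w. length (letters w) \<le> n}"
    using assms by (simp add: degree_le_def)
  then show ?thesis
  proof (induction rule: reg.span_induct_alt)
    case base
    show ?case by (simp add: act_zero_right span_zero)
  next
    case (step c x y)
    then obtain w where w: "x = Poly_Mapping.single w 1" "length (letters w) \<le> n" by auto
    then have "act m x \<in> span ((\<lambda>v. act m (word v)) ` {v. length v \<le> n})"
      by (intro span_base image_eqI[of _ _ "letters w"]) auto
    with step.IH show ?case
      by (simp add: act_add_right act_scale_right span_add span_scale)
  qed
qed

end

text \<open>The leading word \<open>w\<close> of \<open>a\<close> depends on neither
  \<open>m\<close> nor \<open>v\<close>. A word containing \<open>w\<close> is rewritten through
  smaller words by the relation that \<open>a\<close> provides, and well-foundedness of the order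
  ends the process.\<close>

lemma act_word_reduction:
  fixes act :: "'m::ab_group_add \<Rightarrow> ('x::finite, 'k::field) free_algebra \<Rightarrow> 'm"
  assumes "right_module act" and "a \<noteq> 0" and ann: "\<And>m. act m a = 0"
  obtains w :: "'x list"
  where "\<And>m v. act m (word v) \<in>
    module.span (ground_scale act) ((\<lambda>v. act m (word v)) ` (\<Union>i\<le>length v. avoiding w i))"
proof -
  interpret right_module act by fact
  let ?c = "Poly_Mapping.lookup a" and ?K = "Poly_Mapping.keys a"
  obtain L :: "('x list \<times> 'x list) set"
    where wf: "wf L" and tot: "total L" and tr: "trans L"
      and len: "\<And>u v. (u, v) \<in> L \<Longrightarrow> length u \<le> length v"
      and app: "\<And>p q u v. (u, v) \<in> L \<Longrightarrow> (p @ u @ q, p @ v @ q) \<in> L"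
    using word_order by blast
  have asym: "(v, u) \<notin> L" if "(u, v) \<in> L" for u v
    using that wf wf_asym by metis
  \<comment> \<open>The support of \<open>a\<close> is finite and nonempty, so it has a maximal
    word; by totality all its other words lie below that one.\<close>
  have "\<exists>k\<in>?K. \<forall>u\<in>?K. u \<noteq> k \<longrightarrow> (letters k, letters u) \<notin> L"
    using \<open>a \<noteq> 0\<close> asym tr
    by (intro Finite_Set.bex_max_element[where R = "\<lambda>u v. (letters u, letters v) \<in> L"])
      (auto intro!: transp_onI dest: transD)
  then obtain k where k: "k \<in> ?K" and max: "\<And>u. u \<in> ?K - {k} \<Longrightarrow> (letters k, letters u) \<notin> L"
    by blast
  define w where "w = letters k"
  have lower: "(letters u, w) \<in> L" if "u \<in> ?K - {k}" for u
    using max[OF that] tot that monomial.expand[of u k] by (auto simp: w_def total_on_def)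
  have "act m (word v) \<in> span ((\<lambda>v. act m (word v)) ` (\<Union>i\<le>length v. avoiding w i))" for m v
    using wf
  proof (induction v rule: wf_induct_rule)
    case (less v)
    let ?S = "\<lambda>v. span ((\<lambda>v. act m (word v)) ` (\<Union>i\<le>length v. avoiding w i))"
    show ?case
    proof (cases "sublist w v")
      case False
      then have "v \<in> (\<Union>i\<le>length v. avoiding w i)" by (simp add: avoiding_def)
      then show ?thesis by (intro span_base imageI)
    next
      case True
      then obtain p q where v: "v = p @ w @ q" by (auto simp: sublist_def)
      let ?t = "\<lambda>u. ground_scale act (?c u) (act m (word (p @ letters u @ q)))"
      \<comment> \<open>The relation \<open>m p a q = 0\<close>, expanded over the words of
        \<open>a\<close>; the term of \<open>k\<close> is the multiple of \<open>m v\<close> to be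
        solved for.\<close>
      have "(\<Sum>u\<in>?K. ?t u) = act (act (act m (word p)) a) (word q)"
        by (simp add: act_eq_sum[of _ a] act_sum_left act_word_scale act_word_append)
      then have "?t k + (\<Sum>u\<in>?K - {k}. ?t u) = 0"
        using k by (simp add: ann act_zero_left sum.remove[of ?K k])
      then have "ground_scale act (?c k) (act m (word v)) = - (\<Sum>u\<in>?K - {k}. ?t u)"
        by (simp add: v w_def eq_neg_iff_add_eq_0)
      moreover have "?t u \<in> ?S v" if u: "u \<in> ?K - {k}" for u
      proof -
        have lt: "(p @ letters u @ q, v) \<in> L" unfolding v by (intro app lower u)
        \<comment> \<open>A smaller word is not longer, so its reduction uses only words already
          allowed for \<open>v\<close>.\<close>
        have "?S (p @ letters u @ q) \<subseteq> ?S v"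
          by (intro span_mono image_mono UN_mono) (use len[OF lt] in auto)
        with less.IH[OF lt] show ?thesis by (intro span_scale) auto
      qed
      ultimately have "ground_scale act (?c k) (act m (word v)) \<in> ?S v"
        by (metis (no_types, lifting) span_neg span_sum)
      then have "ground_scale act (inverse (?c k)) (ground_scale act (?c k) (act m (word v))) \<in> ?S v"
        by (rule span_scale)
      moreover have "?c k \<noteq> 0" using k by (simp add: in_keys_iff)
      ultimately show ?thesis by simp
    qed
  qed
  then show ?thesis by (rule that)
qed

section \<open>The growth of a module with nonzero annihilator\<close>

text \<open>By the reduction, \<open>A R(n)\<close> is spanned by the \<open>m v\<close> with
  \<open>m\<close> in \<open>A\<close> and \<open>v\<close> avoiding \<open>w\<close>, so the
  dimension is at most \<open>card A\<close> times the number of such words.\<close>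

lemma growth_bound:
  fixes act :: "'m::ab_group_add \<Rightarrow> ('x::finite, 'k::field) free_algebra \<Rightarrow> 'm"
  assumes "right_module act" and "CARD('x) > 1" and "finite A"
    and "a \<noteq> 0" and "\<And>m. act m a = 0"
  obtains K s :: real where "K > 0" "1 \<le> s" "s < CARD('x)"
    "\<And>n. growth act A n \<le> K * (real n + 1) * s ^ n"
proof -
  interpret right_module act by fact
  obtain w :: "'x list" where w: "\<And>m v. act m (word v) \<in>
      span ((\<lambda>v. act m (word v)) ` (\<Union>i\<le>length v. avoiding w i))"
    using act_word_reduction[OF assms(1,4,5)] by blast
  obtain K s :: real where K: "K > 0" and s: "1 \<le> s" "s < CARD('x)"
    and le: "\<And>n. card (\<Union>i\<le>n. avoiding w i) \<le> K * (real n + 1) * s ^ n"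
    using card_avoiding_atMost[OF assms(2), of w] by metis
  have g: "growth act A n \<le> card A * card (\<Union>i\<le>n. avoiding w i)" for n
  proof -
    let ?V = "\<Union>i\<le>n. avoiding w i"
    let ?B = "(\<lambda>(m, v). act m (word v)) ` (A \<times> ?V)"
    have fin: "finite (A \<times> ?V)" using \<open>finite A\<close> finite_avoiding by blast
    have "act m b \<in> span ?B" if m: "m \<in> A" and b: "b \<in> degree_le n" for m b
    proof -
      have "(\<lambda>v. act m (word v)) ` {v. length v \<le> n} \<subseteq> span ?B"
      proof safe
        fix v :: "'x list" assume "length v \<le> n"
        then have "(\<lambda>v. act m (word v)) ` (\<Union>i\<le>length v. avoiding w i) \<subseteq> ?B"
          using m by force
        then show "act m (word v) \<in> span ?B" using w[of m v] span_mono by (meson subsetD)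
      qed
      then show ?thesis
        using act_degree_le_in_span[OF b] span_minimal[OF _ subspace_span] by blast
    qed
    then have "growth_space act A n \<subseteq> span ?B"
      unfolding growth_space_def by (intro span_minimal subspace_span) auto
    then have "growth act A n \<le> card ?B"
      unfolding growth_def using fin by (intro dim_le_card) auto
    also have "\<dots> \<le> card (A \<times> ?V)" by (rule card_image_le[OF fin])
    finally show ?thesis by (simp add: card_cartesian_product)
  qed
  show ?thesis
  \<comment> \<open>The added 1 keeps the constant positive when \<open>A\<close> is empty.\<close>
  proof (rule that[of "(real (card A) + 1) * K" s])
    fix n
    have "real (growth act A n) \<le> real (card A) * card (\<Union>i\<le>n. avoiding w i)"
      using g[of n] by (simp flip: of_nat_mult)
    also have "\<dots> \<le> (real (card A) + 1) * (K * (real n + 1) * s ^ n)"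
      using le[of n] by (intro mult_mono) auto
    finally show "growth act A n \<le> (real (card A) + 1) * K * (real n + 1) * s ^ n" by (simp add: mult_ac)
  qed (use K s in auto)
qed

text \<open>With a nonzero annihilator, the roots are eventually bounded below by a sequence tending
  to \<open>r / s > 1\<close>. Positivity is asked only eventually because maximal growth supplies
  it only from some index on.\<close>

lemma limsup_root_le_one_imp_faithful:
  fixes act :: "'m::ab_group_add \<Rightarrow> ('x::finite, 'k::field) free_algebra \<Rightarrow> 'm"
  assumes mod: "right_module act" and r: "CARD('x) > 1" and A: "finite A"
    and pos: "eventually (\<lambda>n. growth act A n > 0) sequentially"
    and lim: "limsup (\<lambda>n. ereal (root n (CARD('x) ^ n / growth act A n))) \<le> 1"
  shows "faithful act"
proof (rule ccontr)
  interpret right_module act by fact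
  assume "\<not> faithful act"
  then obtain a where "a \<noteq> 0" "\<And>m. act m a = 0"
    using act_zero_right by (auto simp: faithful_def annihilator_def)
  with mod r A obtain K s :: real where K: "K > 0" and s: "1 \<le> s" "s < CARD('x)"
    and le: "\<And>n. growth act A n \<le> K * (real n + 1) * s ^ n"
    using growth_bound by metis
  \<comment> \<open>This is the \<open>n\<close>-th root of
    \<open>r ^ n / (2 * K * n * s ^ n)\<close> for \<open>n > 0\<close>, split so that both roots in
    the denominator tend to 1.\<close>
  define h where "h n = CARD('x) / s / (root n (2 * K) * root n n)" for n :: nat
  have "h \<longlonglongrightarrow> CARD('x) / s / (1 * 1)"
    unfolding h_def using K by (intro tendsto_intros LIMSEQ_root LIMSEQ_root_const) auto
  then have "limsup (\<lambda>n. ereal (h n)) = ereal (CARD('x) / s)"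
    by (intro lim_imp_Limsup) (auto simp: tendsto_ereal)
  moreover have "limsup (\<lambda>n. ereal (h n)) \<le> limsup (\<lambda>n. ereal (root n (CARD('x) ^ n / growth act A n)))"
  proof (rule Limsup_mono)
    show "\<forall>\<^sub>F n in sequentially. ereal (h n) \<le> ereal (root n (CARD('x) ^ n / growth act A n))"
      using pos eventually_gt_at_top[of 0]
    proof eventually_elim
      case (elim n)
      \<comment> \<open>Here \<open>n + 1 \<le> 2 * n\<close>, as \<open>n\<close> is
        positive.\<close>
      have "K * (real n + 1) * s ^ n \<le> 2 * K * n * s ^ n"
        using elim K s by (intro mult_right_mono) auto
      with le[of n] have "growth act A n \<le> 2 * K * n * s ^ n" by linarith
      then have "CARD('x) ^ n / (2 * K * n * s ^ n) \<le> CARD('x) ^ n / growth act A n"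
        using elim by (intro divide_left_mono) auto
      then have "root n (CARD('x) ^ n / (2 * K * n * s ^ n)) \<le> root n (CARD('x) ^ n / growth act A n)"
        using elim by simp
      moreover have "root n (CARD('x) ^ n / (2 * K * n * s ^ n)) = h n"
        using elim s by (simp add: h_def real_root_divide real_root_mult real_root_pos2)
      ultimately show ?case by simp
    qed
  qed
  ultimately have "ereal (CARD('x) / s) \<le> 1" using lim by (metis order_trans)
  then show False using s by (simp add: field_simps)
qed

text \<open>Equivalence with the free module yields a shift \<open>C\<close> with
  \<open>r ^ (n - C) \<le> growth act A n\<close> for \<open>n \<ge> C\<close>. So the quotient is
  eventually at most the constant \<open>r ^ C\<close>, whose \<open>n\<close>-th roots tend to
  1.\<close>

lemma maximal_growth_imp_faithful:
  fixes act :: "'m::ab_group_add \<Rightarrow> ('x::finite, 'k::field) free_algebra \<Rightarrow> 'm"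
  assumes "right_module act" and "CARD('x) > 1" and "maximal_growth act"
  shows "faithful act"
proof -
  let ?r = "CARD('x)"
  obtain A C where A: "finite A" and le: "\<And>n. (\<Sum>i\<le>n. ?r ^ i) \<le> growth act A (n + C)"
    using assms(3) unfolding maximal_growth_def fg_maximal_growth_def growth_equivalent_def growth_regular
    by blast
  have pow: "?r ^ n \<le> growth act A (n + C)" for n
    using le[of n] member_le_sum[of n "{..n}" "\<lambda>i. ?r ^ i"] by simp
  have bound: "?r ^ n \<le> ?r ^ C * growth act A n" "growth act A n > 0" if "n \<ge> C" for n
  proof -
    have *: "?r ^ (n - C) \<le> growth act A n" using pow[of "n - C"] that by simp
    have "?r ^ n = ?r ^ C * ?r ^ (n - C)" using that by (simp flip: power_add)
    with * show "?r ^ n \<le> ?r ^ C * growth act A n" by simp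
    from * show "growth act A n > 0" by (rule less_le_trans[rotated]) simp
  qed
  show ?thesis
  proof (rule limsup_root_le_one_imp_faithful[OF assms(1,2) A])
    show "\<forall>\<^sub>F n in sequentially. growth act A n > 0"
      using eventually_ge_at_top[of C] by eventually_elim (rule bound)
    have "(\<lambda>n. root n (real ?r ^ C)) \<longlonglongrightarrow> 1" by (rule LIMSEQ_root_const) simp
    then have "limsup (\<lambda>n. ereal (root n (real ?r ^ C))) = ereal 1"
      by (intro lim_imp_Limsup) (auto simp: tendsto_ereal)
    moreover have "limsup (\<lambda>n. ereal (root n (?r ^ n / growth act A n)))
      \<le> limsup (\<lambda>n. ereal (root n (real ?r ^ C)))"
    proof (rule Limsup_mono)
      show "\<forall>\<^sub>F n in sequentially. ereal (root n (?r ^ n / growth act A n)) \<le> ereal (root n (real ?r ^ C))"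
        using eventually_ge_at_top[of C] eventually_gt_at_top[of 0]
      proof eventually_elim
        case (elim n)
        have "real (?r ^ n) \<le> real (?r ^ C * growth act A n)"
          using bound(1)[of n] elim by (simp only: of_nat_le_iff)
        then have "?r ^ n / growth act A n \<le> real ?r ^ C"
          using bound(2)[of n] elim by (simp add: divide_le_eq)
        then show ?case using elim by simp
      qed
    qed
    ultimately show "limsup (\<lambda>n. ereal (root n (?r ^ n / growth act A n))) \<le> 1"
      by (simp add: one_ereal_def)
  qed
qed

theorem proposition8:
  fixes act :: "'m::ab_group_add \<Rightarrow> ('x::finite, 'k::field) free_algebra \<Rightarrow> 'm"
  assumes "right_module act"
    and "CARD('x) > 1"
  shows "(\<forall>A. finite A \<and> generated_submodule act A = UNIV \<and>
            subexponential (\<lambda>n. real (CARD('x) ^ n) / real (growth act A n))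
            \<longrightarrow> faithful act)
       \<and> (maximal_growth act \<longrightarrow> faithful act)"
proof (intro conjI allI impI; (elim conjE)?)
  fix A
  assume A: "finite A" and sub: "subexponential (\<lambda>n. real (CARD('x) ^ n) / real (growth act A n))"
  \<comment> \<open>A zero growth value would make the quotient 0 by the convention for division,
    against the positivity in \<open>subexponential\<close>.\<close>
  have "growth act A n > 0" for n
    using sub by (auto simp: subexponential_def zero_less_divide_iff)
  then show "faithful act"
    using sub by (intro limsup_root_le_one_imp_faithful[OF assms A]) (auto simp: subexponential_def)
qed (rule maximal_growth_imp_faithful[OF assms])

end
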